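(* Let $N\ge 2$ be an integer. For every feasible placement vector $x$, its orbit under the $D_4$ action contains at least one feasible placement vector satisfying the corner-ordering inequalities $$H^{\mathrm{TL}}\ge H^{\mathrm{TR}},\qquad H^{\mathrm{TL}}\ge H^{\mathrm{BL}},\qquad H^{\mathrm{TL}}\ge H^{\mathrm{BR}},\qquad H^{\mathrm{TR}}\ge H^{\mathrm{BL}}.$$ Consequently, adding these inequalities to either the exact-cover formulation or the Corner-Difference MILP (CD-MILP) does not change the optimal objective value.
   Context: Let $N\ge 2$ be an integer. The set of placements is $\mathcal P=\{(i,j,h)\in\mathbb Z^3 : 1\le h\le N-1,\ 1\le i,j\le N-h+1\}$; the triple $(i,j,h)$ represents an $h\times h$ square with upper-left cell $(i,j)$ (row $i$, column $j$), covering the cells $\{i,\dots,i+h-1\}\times\{j,\dots,j+h-1\}$ of the $N\times N$ grid of unit cells $(u,v)$, $1\le u,v\le N$. Exact-cover formulation: minimize $\sum_{(i,j,h)\in\mathcal P}x_{i,j,h}$ subject to $$\sum_{\substack{(i,j,h)\in\mathcal P:\\ i\le u\le i+h-1,\ j\le v\le j+h-1}}x_{i,j,h}=1\quad\text{for all }u,v\in\{1,\dots,N\},$$ and $x_{i,j,h}\in\{0,1\}$ for all $(i,j,h)\in\mathcal P$. A feasible placement vector is a vector $x=(x_{i,j,h})_{(i,j,h)\in\mathcal P}$ satisfying these constraints. Corner coefficients: for $(i,j,h)\in\mathcal P$ and $1\le p,q\le N+1$, let $\alpha^{p,q}_{i,j,h}=+1$ if $(p,q)=(i,j)$ or $(p,q)=(i+h,j+h)$;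 $\alpha^{p,q}_{i,j,h}=-1$ if $(p,q)=(i+h,j)$ or $(p,q)=(i,j+h)$; and $\alpha^{p,q}_{i,j,h}=0$ otherwise. CD-MILP, in the variables $x_{i,j,h}$ ($(i,j,h)\in\mathcal P$), $d_{p,q}$ ($1\le p,q\le N+1$), $c_{u,v}$ ($0\le u,v\le N$): minimize $\sum_{(i,j,h)\in\mathcal P}x_{i,j,h}$ subject to - $d_{p,q}=\sum_{(i,j,h)\in\mathcal P}\alpha^{p,q}_{i,j,h}\,x_{i,j,h}$ for $1\le p,q\le N+1$; - $c_{u,v}=c_{u-1,v}+c_{u,v-1}-c_{u-1,v-1}+d_{u,v}$ for $1\le u,v\le N$; - $c_{0,v}=0$ for $0\le v\le N$; - $c_{u,0}=0$ for $1\le u\le N$; - $c_{u,v}=1$ for $1\le u,v\le N$; - $d_{p,q}\in\mathbb Z$ for $1\le p,q\le N+1$ and $c_{u,v}\in\mathbb Z$ for $0\le u,v\le N$; - $x_{i,j,h}\in\{0,1\}$ for $(i,j,h)\in\mathcal P$. $D_4$ action: the dihedral group $D_4$ of the eight symmetries (four rotations, including the identity, and four reflections) of the $N\times N$ square acts on placements by mapping each placed square to its image square, with the same side length; for example the $90^\circ$ clockwise rotation maps $(i,j,h)$ to $(j,\,N-i-h+2,\,h)$, and the reflection across the main diagonal maps $(i,j,h)$ to $(j,i,h)$ (these two generate the action). It acts on placement vectors by the corresponding permutation of coordinates: $(g\cdot x)_{g(i,j,h)}=x_{i,j,h}$ for $g\in D_4$. Corner quantities of a placement vector $x$: $$H^{\mathrm{TL}}=\sum_{h=1}^{N-1}h\,x_{1,1,h},\quad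 H^{\mathrm{TR}}=\sum_{h=1}^{N-1}h\,x_{1,N-h+1,h},\quad H^{\mathrm{BL}}=\sum_{h=1}^{N-1}h\,x_{N-h+1,1,h},\quad H^{\mathrm{BR}}=\sum_{h=1}^{N-1}h\,x_{N-h+1,N-h+1,h}.$$ *)

theory Defs
  imports Complex_Main "HOL-Library.FuncSet" "HOL-Algebra.Group_Action"
begin

type_synonym cell = "int \<times> int"
type_synonym placement = "int \<times> int \<times> int"

definition placements :: "int \<Rightarrow> placement set" where
  "placements N = {(i, j, h). 1 \<le> h \<and> h \<le> N - 1 \<and>
     1 \<le> i \<and> i \<le> N - h + 1 \<and> 1 \<le> j \<and> j \<le> N - h + 1}"

definition cells :: "placement \<Rightarrow> cell set" where
  "cells = (\<lambda>(i, j, h). {i..i + h - 1} \<times> {j..j + h - 1})"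

text \<open>
  A vector indexed by a finite set \<open>I\<close> is an extensional function on \<open>I\<close>
  (\<open>I \<rightarrow>\<^sub>E A\<close>), so that equality of vectors is equality of their \<open>I\<close>-coordinates.
\<close>

definition exact_cover_feasible :: "int \<Rightarrow> (placement \<Rightarrow> real) set" where
  "exact_cover_feasible N = {x \<in> placements N \<rightarrow>\<^sub>E {0, 1}.
     \<forall>u\<in>{1..N}. \<forall>v\<in>{1..N}. (\<Sum>s | s \<in> placements N \<and> (u, v) \<in> cells s. x s) = 1}"

definition num_squares :: "int \<Rightarrow> (placement \<Rightarrow> real) \<Rightarrow> real" where
  "num_squares N x = (\<Sum>s\<in>placements N. x s)"

definition corner_coeff :: "int \<Rightarrow> int \<Rightarrow> placement \<Rightarrow> real" where
  "corner_coeff p q = (\<lambda>(i, j, h).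
     if (p, q) = (i, j) \<or> (p, q) = (i + h, j + h) then 1
     else if (p, q) = (i + h, j) \<or> (p, q) = (i, j + h) then -1
     else 0)"

definition cd_feasible ::
    "int \<Rightarrow> ((placement \<Rightarrow> real) \<times> (int \<times> int \<Rightarrow> real) \<times> (int \<times> int \<Rightarrow> real)) set" where
  "cd_feasible N = {(x, d, c).
     x \<in> placements N \<rightarrow>\<^sub>E {0, 1} \<and>
     d \<in> {1..N + 1} \<times> {1..N + 1} \<rightarrow>\<^sub>E \<int> \<and>
     c \<in> {0..N} \<times> {0..N} \<rightarrow>\<^sub>E \<int> \<and>
     (\<forall>p\<in>{1..N + 1}. \<forall>q\<in>{1..N + 1}.
        d (p, q) = (\<Sum>s\<in>placements N. corner_coeff p q s * x s)) \<and>
     (\<forall>u\<in>{1..N}. \<forall>v\<in>{1..N}.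
        c (u, v) = c (u - 1, v) + c (u, v - 1) - c (u - 1, v - 1) + d (u, v)) \<and>
     (\<forall>v\<in>{0..N}. c (0, v) = 0) \<and>
     (\<forall>u\<in>{1..N}. c (u, 0) = 0) \<and>
     (\<forall>u\<in>{1..N}. \<forall>v\<in>{1..N}. c (u, v) = 1)}"

text \<open>
  The eight symmetries of the square, as maps on (row, column) coordinates of cells: the
  rotations by 0, 90 (clockwise), 180 and 270 degrees, then the reflections across the main
  diagonal, the vertical axis, the horizontal axis and the anti-diagonal.
\<close>

definition square_symmetries :: "int \<Rightarrow> (cell \<Rightarrow> cell) set" where
  "square_symmetries N =
    {\<lambda>(u, v). (u, v),
     \<lambda>(u, v). (v, N + 1 - u),
     \<lambda>(u, v). (N + 1 - u, N + 1 - v),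
     \<lambda>(u, v). (N + 1 - v, u),
     \<lambda>(u, v). (v, u),
     \<lambda>(u, v). (u, N + 1 - v),
     \<lambda>(u, v). (N + 1 - u, v),
     \<lambda>(u, v). (N + 1 - v, N + 1 - u)}"

definition D4 :: "int \<Rightarrow> (cell \<Rightarrow> cell) monoid" where
  "D4 N = \<lparr>carrier = square_symmetries N, mult = (\<circ>), one = id\<rparr>"

definition act_placement :: "int \<Rightarrow> (cell \<Rightarrow> cell) \<Rightarrow> placement \<Rightarrow> placement" where
  "act_placement N g s = (THE t. t \<in> placements N \<and> cells t = g ` cells s)"

text \<open>
  The permutation of coordinates is characterised by \<open>(g \<cdot> x) (g \<cdot> s) = x s\<close>; see
  \<open>act_vector_act_placement\<close> below.
\<close>

definition act_vector ::
    "int \<Rightarrow> (cell \<Rightarrow> cell) \<Rightarrow> (placement \<Rightarrow> real) \<Rightarrow> (placement \<Rightarrow> real)" where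
  "act_vector N g x =
     (\<lambda>t\<in>placements N. x (inv_into (placements N) (act_placement N g) t))"

definition H_TL :: "int \<Rightarrow> (placement \<Rightarrow> real) \<Rightarrow> real" where
  "H_TL N x = (\<Sum>h = 1..N - 1. of_int h * x (1, 1, h))"

definition H_TR :: "int \<Rightarrow> (placement \<Rightarrow> real) \<Rightarrow> real" where
  "H_TR N x = (\<Sum>h = 1..N - 1. of_int h * x (1, N - h + 1, h))"

definition H_BL :: "int \<Rightarrow> (placement \<Rightarrow> real) \<Rightarrow> real" where
  "H_BL N x = (\<Sum>h = 1..N - 1. of_int h * x (N - h + 1, 1, h))"

definition H_BR :: "int \<Rightarrow> (placement \<Rightarrow> real) \<Rightarrow> real" where
  "H_BR N x = (\<Sum>h = 1..N - 1. of_int h * x (N - h + 1, N - h + 1, h))"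

definition corner_ordered :: "int \<Rightarrow> (placement \<Rightarrow> real) \<Rightarrow> bool" where
  "corner_ordered N x \<longleftrightarrow>
     H_TL N x \<ge> H_TR N x \<and> H_TL N x \<ge> H_BL N x \<and> H_TL N x \<ge> H_BR N x \<and> H_TR N x \<ge> H_BL N x"

definition is_optimal_value :: "('a \<Rightarrow> real) \<Rightarrow> 'a set \<Rightarrow> real \<Rightarrow> bool" where
  "is_optimal_value f S z \<longleftrightarrow> (\<exists>x. is_arg_min f (\<lambda>y. y \<in> S) x \<and> f x = z)"

lemma is_optimal_value_unique:
  "is_optimal_value f S z \<Longrightarrow> is_optimal_value f S z' \<Longrightarrow> z = z'"
  by (force simp: is_optimal_value_def is_arg_min_def)

lemma group_D4: "group (D4 N)"
proof (rule groupI)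
  fix f g assume "f \<in> carrier (D4 N)" "g \<in> carrier (D4 N)"
  then show "f \<otimes>\<^bsub>D4 N\<^esub> g \<in> carrier (D4 N)"
    by (auto simp: D4_def square_symmetries_def fun_eq_iff)
next
  fix f assume "f \<in> carrier (D4 N)"
  then show "\<exists>g\<in>carrier (D4 N). g \<otimes>\<^bsub>D4 N\<^esub> f = \<one>\<^bsub>D4 N\<^esub>"
    by (auto simp: D4_def square_symmetries_def fun_eq_iff)
qed (auto simp: D4_def square_symmetries_def fun_eq_iff)

lemma cells_inject:
  assumes "s \<in> placements N" "t \<in> placements N" "cells s = cells t"
  shows "s = t"
  using assms by (auto simp: placements_def cells_def times_eq_iff)

lemma act_placement_eqI:
  assumes "t \<in> placements N" "cells t = g ` cells s"
  shows "act_placement N g s = t"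
  unfolding act_placement_def
proof (rule the_equality)
  fix t' assume "t' \<in> placements N \<and> cells t' = g ` cells s"
  then show "t' = t"
    using assms cells_inject[of t' N t] by simp
qed (use assms in simp)

lemma act_placement_rotation:
  assumes "(i, j, h) \<in> placements N"
  shows "act_placement N (\<lambda>(u, v). (v, N + 1 - u)) (i, j, h) = (j, N - i - h + 2, h)"
proof (rule act_placement_eqI)
  show "cells (j, N - i - h + 2, h) = (\<lambda>(u, v). (v, N + 1 - u)) ` cells (i, j, h)"
  proof (intro equalityI subsetI)
    fix c assume "c \<in> cells (j, N - i - h + 2, h)"
    then show "c \<in> (\<lambda>(u, v). (v, N + 1 - u)) ` cells (i, j, h)"
      by (intro image_eqI[of _ _ "(N + 1 - snd c, fst c)"]) (auto simp: cells_def)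
  qed (auto simp: cells_def)
qed (use assms in \<open>auto simp: placements_def\<close>)

lemma act_placement_transpose:
  assumes "(i, j, h) \<in> placements N"
  shows "act_placement N (\<lambda>(u, v). (v, u)) (i, j, h) = (j, i, h)"
proof (rule act_placement_eqI)
  show "cells (j, i, h) = (\<lambda>(u, v). (v, u)) ` cells (i, j, h)"
    by (auto simp: cells_def image_iff)
qed (use assms in \<open>auto simp: placements_def\<close>)

lemma ex_act_placement:
  assumes g: "g \<in> square_symmetries N" and s: "s \<in> placements N"
  shows "\<exists>t\<in>placements N. cells t = g ` cells s"
proof -
  obtain i j h where ijh: "s = (i, j, h)" by (cases s)
  define i' j' where "i' = N - i - h + 2" and "j' = N - j - h + 2"
  have cells_iff: "cells (a, b, h) = f ` cells s"
    if "\<And>c. f' (f c) = c" "\<And>c. f (f' c) = c"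
      "\<And>c. c \<in> cells (a, b, h) \<longleftrightarrow> f' c \<in> cells (i, j, h)"
    for f f' :: "cell \<Rightarrow> cell" and a b
  proof -
    have "c \<in> f ` cells s \<longleftrightarrow> f' c \<in> cells s" for c
      using that(1)[of c] that(1) that(2)[of c] by (metis imageE imageI)
    then show ?thesis using that(3) unfolding ijh by blast
  qed
  have "\<exists>t\<in>{(i, j, h), (j, i', h), (i', j', h), (j', i, h),
          (j, i, h), (i, j', h), (i', j, h), (j', i', h)}. cells t = g ` cells s"
    using g[unfolded square_symmetries_def]
    apply (elim insertE emptyE)
    subgoal by (intro bexI[of _ "(i, j, h)"]) (auto simp: ijh)
    subgoal by (intro bexI[of _ "(j, i', h)"] cells_iff[where f' = "\<lambda>(u, v). (N + 1 - v, u)"])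
        (auto simp: cells_def i'_def)
    subgoal by (intro bexI[of _ "(i', j', h)"] cells_iff[where f' = "\<lambda>(u, v). (N + 1 - u, N + 1 - v)"])
        (auto simp: cells_def i'_def j'_def)
    subgoal by (intro bexI[of _ "(j', i, h)"] cells_iff[where f' = "\<lambda>(u, v). (v, N + 1 - u)"])
        (auto simp: cells_def j'_def)
    subgoal by (intro bexI[of _ "(j, i, h)"] cells_iff[where f' = "\<lambda>(u, v). (v, u)"])
        (auto simp: cells_def)
    subgoal by (intro bexI[of _ "(i, j', h)"] cells_iff[where f' = "\<lambda>(u, v). (u, N + 1 - v)"])
        (auto simp: cells_def j'_def)
    subgoal by (intro bexI[of _ "(i', j, h)"] cells_iff[where f' = "\<lambda>(u, v). (N + 1 - u, v)"])
        (auto simp: cells_def i'_def)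
    subgoal by (intro bexI[of _ "(j', i', h)"] cells_iff[where f' = "\<lambda>(u, v). (N + 1 - v, N + 1 - u)"])
        (auto simp: cells_def i'_def j'_def)
    done
  moreover have "{(i, j, h), (j, i', h), (i', j', h), (j', i, h),
          (j, i, h), (i, j', h), (i', j, h), (j', i', h)} \<subseteq> placements N"
    using s by (auto simp: ijh placements_def i'_def j'_def)
  ultimately show ?thesis by blast
qed

lemma bij_betw_act_placement:
  assumes g: "g \<in> square_symmetries N"
  shows "bij_betw (act_placement N g) (placements N) (placements N)"
proof -
  have act: "act_placement N g s \<in> placements N \<and> cells (act_placement N g s) = g ` cells s"
    if "s \<in> placements N" for s
    using ex_act_placement[OF g that] act_placement_eqI by metis
  have "inj g"
    using g by (auto simp: square_symmetries_def inj_def)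
  then have inj: "inj_on (act_placement N g) (placements N)"
    by (metis act cells_inject inj_image_eq_iff inj_onI)
  have "placements N \<subseteq> (\<lambda>(i, j, h). (i, j, h)) ` ({1..N} \<times> {1..N} \<times> {1..N})"
    by (auto simp: placements_def)
  then have "finite (placements N)"
    by (rule finite_subset) auto
  with inj act show ?thesis
    by (simp add: bij_betw_def endo_inj_surj image_subset_iff)
qed

lemma act_vector_act_placement:
  assumes "g \<in> carrier (D4 N)" "s \<in> placements N"
  shows "act_vector N g x (act_placement N g s) = x s"
  using assms bij_betw_act_placement[of g N]
  by (auto simp: act_vector_def D4_def bij_betw_def)

end

theory Submission
  imports Defs
begin

text \<open>
  For a weight \<open>w\<close> on placements, sum \<open>w s * x s\<close> over the placements \<open>s\<close> that contain a given
  cell \<open>c\<close>. With weight 1 this is the left-hand side of the covering constraint at \<open>c\<close>; with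
  the side length as weight, at the four corner cells, it is the four corner quantities, because a
  square in the grid that contains a corner cell must sit in that corner. If \<open>w\<close> is
  invariant under the symmetry \<open>g\<close>, then the sum for \<open>g \<cdot> x\<close> at \<open>g c\<close> equals the sum for
  \<open>x\<close> at \<open>c\<close> (\<open>cell_sum_act_vector\<close>). This one fact shows both that symmetries preserve
  feasibility and that they permute the corner quantities as they permute the corners.

  It remains to choose the symmetry: some rotation moves a corner with the largest value to the
  top left, and a transposition, which fixes that corner, puts the two neighbouring corners
  in order (\<open>ex_symmetry_sorting_corners\<close>). The number of squares is invariant, so an optimal
  vector can be replaced by an ordered one of the same value.

  For the Corner-Difference MILP, the corner coefficients are the mixed second difference of the
  indicator function of a square (\<open>corner_coeff_eq_mixed_difference\<close>). Hence the recurrence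
  for \<open>c\<close> with its zero boundary forces \<open>c\<close> to be the covering count, and the feasible set is a
  copy of the exact-cover feasible set in which \<open>d\<close> and \<open>c\<close> are determined by \<open>x\<close>
  (\<open>cd_feasible_eq_image\<close>).
\<close>

section \<open>Symmetries acting on sums over the squares at a cell\<close>

definition cell_sum :: "int \<Rightarrow> (placement \<Rightarrow> real) \<Rightarrow> (placement \<Rightarrow> real) \<Rightarrow> cell \<Rightarrow> real" where
  "cell_sum N w x c = (\<Sum>s | s \<in> placements N \<and> c \<in> cells s. w s * x s)"

definition side :: "placement \<Rightarrow> real" where
  "side = (\<lambda>(i, j, h). of_int h)"

lemma finite_placements: "finite (placements N)"
proof (rule finite_subset)
  show "placements N \<subseteq> {1..N} \<times> {1..N} \<times> {1..N}"
    by (auto simp: placements_def)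
qed auto

lemma inj_square_symmetry: "g \<in> square_symmetries N \<Longrightarrow> inj g"
  by (auto simp: square_symmetries_def inj_def)

lemma ex_inverse_symmetry:
  assumes "g \<in> square_symmetries N"
  obtains g' where "g' \<in> square_symmetries N" "\<And>c. g' (g c) = c" "\<And>c. g (g' c) = c"
proof -
  interpret group "D4 N" by (rule group_D4)
  have g: "g \<in> carrier (D4 N)" using assms by (simp add: D4_def)
  have "inv\<^bsub>D4 N\<^esub> g \<in> square_symmetries N"
    using inv_closed[OF g] by (simp add: D4_def)
  moreover have "(inv\<^bsub>D4 N\<^esub> g) (g c) = c" "g ((inv\<^bsub>D4 N\<^esub> g) c) = c" for c
    using fun_cong[OF l_inv[OF g], of c] fun_cong[OF r_inv[OF g], of c] by (simp_all add: D4_def)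
  ultimately show thesis using that by blast
qed

lemma square_symmetry_grid:
  assumes "g \<in> square_symmetries N" "c \<in> {1..N} \<times> {1..N}"
  shows "g c \<in> {1..N} \<times> {1..N}"
  using assms by (auto simp: square_symmetries_def)

lemma act_placement_placements:
  assumes "g \<in> square_symmetries N" "s \<in> placements N"
  shows "act_placement N g s \<in> placements N"
  using bij_betw_apply[OF bij_betw_act_placement] assms by blast

lemma cells_act_placement:
  assumes "g \<in> square_symmetries N" "s \<in> placements N"
  shows "cells (act_placement N g s) = g ` cells s"
  using ex_act_placement[OF assms] act_placement_eqI by metis

text \<open>
  The side length is recovered from the number of cells, which an injective map preserves.
\<close>

lemma side_act_placement:
  assumes g: "g \<in> square_symmetries N" and s: "s \<in> placements N"
  shows "side (act_placement N g s) = side s"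
proof -
  have card: "side t = sqrt (card (cells t))" if "t \<in> placements N" for t
    using that by (auto simp: side_def cells_def placements_def real_sqrt_mult)
  have "card (cells (act_placement N g s)) = card (cells s)"
    unfolding cells_act_placement[OF assms]
    using inj_square_symmetry[OF g] by (intro card_image) (auto intro: inj_on_subset)
  then show ?thesis
    using card s act_placement_placements[OF assms] by simp
qed

lemma act_vector_image:
  assumes "g \<in> square_symmetries N" "s \<in> placements N"
  shows "act_vector N g x (act_placement N g s) = x s"
  using act_vector_act_placement assms by (simp add: D4_def)

text \<open>
  The placements containing \<open>g c\<close> are the images of those containing \<open>c\<close>, so this is a change of
  summation variable.
\<close>

lemma cell_sum_act_vector:
  assumes g: "g \<in> square_symmetries N"
    and w: "\<And>s. s \<in> placements N \<Longrightarrow> w (act_placement N g s) = w s"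
  shows "cell_sum N w (act_vector N g x) (g c) = cell_sum N w x c"
proof -
  let ?a = "act_placement N g"
  have mem: "g c \<in> cells (?a s) \<longleftrightarrow> c \<in> cells s" if "s \<in> placements N" for s
    using cells_act_placement[OF g that] inj_square_symmetry[OF g] by (simp add: inj_image_mem_iff)
  have bij: "bij_betw ?a {s \<in> placements N. c \<in> cells s} {t \<in> placements N. g c \<in> cells t}"
    using bij_betw_act_placement[OF g] mem unfolding bij_betw_def
    by (fastforce intro: inj_on_subset)
  have "cell_sum N w (act_vector N g x) (g c) =
      (\<Sum>s | s \<in> placements N \<and> c \<in> cells s. w (?a s) * act_vector N g x (?a s))"
    unfolding cell_sum_def by (rule sum.reindex_bij_betw[OF bij, symmetric])
  also have "\<dots> = cell_sum N w x c"
    unfolding cell_sum_def by (rule sum.cong) (auto simp: w act_vector_image[OF g])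
  finally show ?thesis .
qed

lemma num_squares_act_vector:
  assumes g: "g \<in> square_symmetries N"
  shows "num_squares N (act_vector N g x) = num_squares N x"
  unfolding num_squares_def
  by (subst sum.reindex_bij_betw[OF bij_betw_act_placement[OF g], symmetric])
    (simp add: act_vector_image[OF g])

lemma exact_cover_feasible_iff:
  "x \<in> exact_cover_feasible N \<longleftrightarrow>
     x \<in> placements N \<rightarrow>\<^sub>E {0, 1} \<and> (\<forall>c\<in>{1..N} \<times> {1..N}. cell_sum N (\<lambda>_. 1) x c = 1)"
  by (auto simp: exact_cover_feasible_def cell_sum_def)

lemma act_vector_feasible:
  assumes g: "g \<in> square_symmetries N" and x: "x \<in> exact_cover_feasible N"
  shows "act_vector N g x \<in> exact_cover_feasible N"
  unfolding exact_cover_feasible_iff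
proof (intro conjI ballI)
  show "act_vector N g x \<in> placements N \<rightarrow>\<^sub>E {0, 1}"
  proof (rule PiE_I)
    fix t assume "t \<in> placements N"
    then obtain s where "s \<in> placements N" "t = act_placement N g s"
      using bij_betw_act_placement[OF g] unfolding bij_betw_def by blast
    then show "act_vector N g x t \<in> {0, 1}"
      using PiE_mem[of x "placements N" "\<lambda>_. {0, 1}" s] x
      by (simp add: act_vector_image[OF g] exact_cover_feasible_iff)
  qed (simp add: act_vector_def)
next
  fix c assume c: "c \<in> {1..N} \<times> {1..N}"
  obtain g' where g': "g' \<in> square_symmetries N" "g (g' c) = c"
    using ex_inverse_symmetry[OF g] by metis
  show "cell_sum N (\<lambda>_. 1) (act_vector N g x) c = 1"
    using cell_sum_act_vector[OF g, of "\<lambda>_. 1" x "g' c"] square_symmetry_grid[OF g'(1) c] x g'(2)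
    unfolding exact_cover_feasible_iff by simp
qed

section \<open>Sorting the corners\<close>

lemma corner_quantities_eq_cell_sum:
  shows "H_TL N x = cell_sum N side x (1, 1)"
    and "H_TR N x = cell_sum N side x (1, N)"
    and "H_BL N x = cell_sum N side x (N, 1)"
    and "H_BR N x = cell_sum N side x (N, N)"
proof -
  show "H_TL N x = cell_sum N side x (1, 1)"
    unfolding H_TL_def cell_sum_def
    by (rule sum.reindex_bij_witness[of _ "\<lambda>(i, j, h). h" "\<lambda>h. (1, 1, h)"])
      (auto simp: placements_def cells_def side_def)
  show "H_TR N x = cell_sum N side x (1, N)"
    unfolding H_TR_def cell_sum_def
    by (rule sum.reindex_bij_witness[of _ "\<lambda>(i, j, h). h" "\<lambda>h. (1, N - h + 1, h)"])
      (auto simp: placements_def cells_def side_def)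
  show "H_BL N x = cell_sum N side x (N, 1)"
    unfolding H_BL_def cell_sum_def
    by (rule sum.reindex_bij_witness[of _ "\<lambda>(i, j, h). h" "\<lambda>h. (N - h + 1, 1, h)"])
      (auto simp: placements_def cells_def side_def)
  show "H_BR N x = cell_sum N side x (N, N)"
    unfolding H_BR_def cell_sum_def
    by (rule sum.reindex_bij_witness[of _ "\<lambda>(i, j, h). h" "\<lambda>h. (N - h + 1, N - h + 1, h)"])
      (auto simp: placements_def cells_def side_def)
qed

text \<open>
  Some rotation \<open>f\<close> takes the top left corner to a corner where \<open>F\<close> is largest. Transposing
  before applying \<open>f\<close> leaves the image of the top left corner in place and exchanges the images of
  the top right and bottom left corners, so one of the two choices orders them as well.
\<close>

lemma ex_symmetry_sorting_corners:
  fixes F :: "cell \<Rightarrow> real"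
  shows "\<exists>f\<in>square_symmetries N. F (f (1, N)) \<le> F (f (1, 1)) \<and> F (f (N, 1)) \<le> F (f (1, 1)) \<and>
           F (f (N, N)) \<le> F (f (1, 1)) \<and> F (f (N, 1)) \<le> F (f (1, N))"
proof -
  have witness: ?thesis
    if "f \<in> square_symmetries N" "F (f (1, N)) \<le> F (f (1, 1))" "F (f (N, 1)) \<le> F (f (1, 1))"
      "F (f (N, N)) \<le> F (f (1, 1))" "F (f (N, 1)) \<le> F (f (1, N))" for f
    using that by blast
  consider
      (TL) "F (1, N) \<le> F (1, 1)" "F (N, 1) \<le> F (1, 1)" "F (N, N) \<le> F (1, 1)"
    | (TR) "F (1, 1) \<le> F (1, N)" "F (N, 1) \<le> F (1, N)" "F (N, N) \<le> F (1, N)"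
    | (BL) "F (1, 1) \<le> F (N, 1)" "F (1, N) \<le> F (N, 1)" "F (N, N) \<le> F (N, 1)"
    | (BR) "F (1, 1) \<le> F (N, N)" "F (1, N) \<le> F (N, N)" "F (N, 1) \<le> F (N, N)"
    by linarith
  then show ?thesis
  proof cases
    case TL
    show ?thesis
    proof (cases "F (N, 1) \<le> F (1, N)")
      case True
      with TL show ?thesis
        by (intro witness[of "\<lambda>(u, v). (u, v)"]) (simp_all add: square_symmetries_def)
    next
      case False
      with TL show ?thesis
        by (intro witness[of "\<lambda>(u, v). (v, u)"]) (simp_all add: square_symmetries_def)
    qed
  next
    case TR
    show ?thesis
    proof (cases "F (1, 1) \<le> F (N, N)")
      case True
      with TR show ?thesis
        by (intro witness[of "\<lambda>(u, v). (v, N + 1 - u)"]) (simp_all add: square_symmetries_def)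
    next
      case False
      with TR show ?thesis
        by (intro witness[of "\<lambda>(u, v). (u, N + 1 - v)"]) (simp_all add: square_symmetries_def)
    qed
  next
    case BL
    show ?thesis
    proof (cases "F (N, N) \<le> F (1, 1)")
      case True
      with BL show ?thesis
        by (intro witness[of "\<lambda>(u, v). (N + 1 - v, u)"]) (simp_all add: square_symmetries_def)
    next
      case False
      with BL show ?thesis
        by (intro witness[of "\<lambda>(u, v). (N + 1 - u, v)"]) (simp_all add: square_symmetries_def)
    qed
  next
    case BR
    show ?thesis
    proof (cases "F (1, N) \<le> F (N, 1)")
      case True
      with BR show ?thesis
        by (intro witness[of "\<lambda>(u, v). (N + 1 - u, N + 1 - v)"]) (simp_all add: square_symmetries_def)
    next
      case False
      with BR show ?thesis
        by (intro witness[of "\<lambda>(u, v). (N + 1 - v, N + 1 - u)"]) (simp_all add: square_symmetries_def)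
    qed
  qed
qed

lemma ex_orbit_corner_ordered:
  assumes x: "x \<in> exact_cover_feasible N"
  shows "\<exists>g\<in>square_symmetries N. act_vector N g x \<in> exact_cover_feasible N \<and>
           corner_ordered N (act_vector N g x)"
proof -
  obtain f where f: "f \<in> square_symmetries N"
    and sorted: "cell_sum N side x (f (1, N)) \<le> cell_sum N side x (f (1, 1))"
      "cell_sum N side x (f (N, 1)) \<le> cell_sum N side x (f (1, 1))"
      "cell_sum N side x (f (N, N)) \<le> cell_sum N side x (f (1, 1))"
      "cell_sum N side x (f (N, 1)) \<le> cell_sum N side x (f (1, N))"
    using ex_symmetry_sorting_corners[of N "cell_sum N side x"] by blast
  \<comment> \<open>Reading \<open>x\<close> at the corners moved by \<open>f\<close> amounts to acting on \<open>x\<close> by the inverse of \<open>f\<close>.\<close>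
  obtain g where g: "g \<in> square_symmetries N" "\<And>c. g (f c) = c"
    using ex_inverse_symmetry[OF f] by metis
  have "cell_sum N side (act_vector N g x) c = cell_sum N side x (f c)" for c
    using cell_sum_act_vector[where w = side and x = x and c = "f c", OF g(1)]
      side_act_placement[OF g(1)] g(2) by simp
  then have "corner_ordered N (act_vector N g x)"
    using sorted by (simp add: corner_ordered_def corner_quantities_eq_cell_sum)
  then show ?thesis
    using g(1) act_vector_feasible[OF g(1) x] by blast
qed

section \<open>The Corner-Difference MILP as a copy of the exact-cover formulation\<close>

text \<open>
  The indicator of a square is a product of indicators of two intervals, and the difference of an
  interval's indicator is +1 at its start and -1 just after its end.
\<close>

lemma corner_coeff_eq_mixed_difference:
  assumes "s \<in> placements N"
  shows "corner_coeff u v s =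
    of_bool ((u, v) \<in> cells s) - of_bool ((u - 1, v) \<in> cells s)
      - of_bool ((u, v - 1) \<in> cells s) + of_bool ((u - 1, v - 1) \<in> cells s)"
proof -
  obtain i j h where s: "s = (i, j, h)" and h: "h \<ge> 1"
    using assms by (auto simp: placements_def)
  define a b :: real where "a = of_bool (u = i) - of_bool (u = i + h)"
    and "b = of_bool (v = j) - of_bool (v = j + h)"
  have a: "a = of_bool (u \<in> {i..i + h - 1}) - of_bool (u - 1 \<in> {i..i + h - 1})"
    and b: "b = of_bool (v \<in> {j..j + h - 1}) - of_bool (v - 1 \<in> {j..j + h - 1})"
    using h by (auto simp: a_def b_def)
  have "corner_coeff u v s = a * b"
    using h by (auto simp: s corner_coeff_def a_def b_def)
  also have "\<dots> = of_bool ((u, v) \<in> cells s) - of_bool ((u - 1, v) \<in> cells s)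
      - of_bool ((u, v - 1) \<in> cells s) + of_bool ((u - 1, v - 1) \<in> cells s)"
    unfolding a b s cells_def by (simp only: prod.case mem_Times_iff fst_conv snd_conv of_bool_conj)
      (simp add: algebra_simps)
  finally show ?thesis .
qed

lemma cell_sum_one_eq:
  "cell_sum N (\<lambda>_. 1) x c = (\<Sum>s\<in>placements N. of_bool (c \<in> cells s) * x s)"
  unfolding cell_sum_def by (rule sum.mono_neutral_cong_left) (auto simp: finite_placements)

lemma sum_corner_coeff_eq_mixed_difference:
  fixes N :: int
  defines "K \<equiv> cell_sum N (\<lambda>_. 1)"
  shows "(\<Sum>s\<in>placements N. corner_coeff u v s * x s) =
    K x (u, v) - K x (u - 1, v) - K x (u, v - 1) + K x (u - 1, v - 1)"
  unfolding K_def cell_sum_one_eq sum_subtractf[symmetric] sum.distrib[symmetric]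
  by (rule sum.cong) (simp_all add: corner_coeff_eq_mixed_difference algebra_simps)

lemma cell_sum_boundary:
  "cell_sum N w x (0, v) = 0" "cell_sum N w x (u, 0) = 0"
  unfolding cell_sum_def by (auto simp: placements_def cells_def intro!: sum.neutral)

lemma zero_if_mixed_difference_zero:
  fixes E :: "int \<Rightarrow> int \<Rightarrow> real"
  assumes rows: "\<And>v. v \<in> {0..N} \<Longrightarrow> E 0 v = 0" and cols: "\<And>u. u \<in> {0..N} \<Longrightarrow> E u 0 = 0"
    and step: "\<And>u v. u \<in> {1..N} \<Longrightarrow> v \<in> {1..N} \<Longrightarrow>
      E u v = E (u - 1) v + E u (v - 1) - E (u - 1) (v - 1)"
    and "u \<in> {0..N}" "v \<in> {0..N}"
  shows "E u v = 0"
proof -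
  have "\<forall>v\<in>{0..N}. E u v = 0" if "0 \<le> u" "u \<le> N" for u
    using that
  proof (induction u rule: int_ge_induct)
    case base
    then show ?case using rows by simp
  next
    case (step u)
    have "E (u + 1) v = 0" if "0 \<le> v" "v \<le> N" for v
      using that
    proof (induction v rule: int_ge_induct)
      case base
      then show ?case using cols step.hyps step.prems by simp
    next
      case (step v)
      then show ?case
        using assms(3)[of "u + 1" "v + 1"] \<open>u + 1 \<le> N\<close> \<open>0 \<le> u\<close>
          \<open>u \<le> N \<Longrightarrow> \<forall>v\<in>{0..N}. E u v = 0\<close> by simp
    qed
    then show ?case by simp
  qed
  then show ?thesis using assms(4,5) by simp
qed

definition corner_differences :: "int \<Rightarrow> (placement \<Rightarrow> real) \<Rightarrow> int \<times> int \<Rightarrow> real" where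
  "corner_differences N x =
     (\<lambda>(p, q)\<in>{1..N + 1} \<times> {1..N + 1}. \<Sum>s\<in>placements N. corner_coeff p q s * x s)"

definition full_cover :: "int \<Rightarrow> int \<times> int \<Rightarrow> real" where
  "full_cover N = (\<lambda>(u, v)\<in>{0..N} \<times> {0..N}. if u = 0 \<or> v = 0 then 0 else 1)"

lemma full_cover_simps:
  assumes "u \<in> {0..N}" "v \<in> {0..N}"
  shows "full_cover N (u, v) = (if u = 0 \<or> v = 0 then 0 else 1)"
  using assms by (simp add: full_cover_def)

text \<open>
  In a point of the MILP, \<open>c\<close> and the covering count of \<open>x\<close> have the same mixed differences and
  both vanish for \<open>u = 0\<close> or \<open>v = 0\<close>, so they agree.
\<close>

lemma cd_feasible_covers:
  assumes "(x, d, c) \<in> cd_feasible N" "u \<in> {0..N}" "v \<in> {0..N}"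
  shows "c (u, v) = cell_sum N (\<lambda>_. 1) x (u, v)"
proof -
  let ?K = "cell_sum N (\<lambda>_. 1) x"
  have bdry: "c (0, v) = 0" if "v \<in> {0..N}" for v
    using assms(1) that by (auto simp: cd_feasible_def)
  have bdry': "c (u, 0) = 0" if "u \<in> {0..N}" for u
    using assms(1) that bdry[of 0] by (cases "u = 0") (auto simp: cd_feasible_def)
  have rec: "c (u, v) = c (u - 1, v) + c (u, v - 1) - c (u - 1, v - 1)
      + (\<Sum>s\<in>placements N. corner_coeff u v s * x s)" if "u \<in> {1..N}" "v \<in> {1..N}" for u v
  proof -
    have "u \<in> {1..N + 1}" "v \<in> {1..N + 1}" using that by auto
    then show ?thesis using assms(1) that unfolding cd_feasible_def by simp
  qed
  have "c (u, v) - ?K (u, v) = 0"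
  proof (rule zero_if_mixed_difference_zero[where N = N and E = "\<lambda>u v. c (u, v) - ?K (u, v)"])
    fix u v assume "u \<in> {1..N}" "v \<in> {1..N}"
    then show "c (u, v) - ?K (u, v) = c (u - 1, v) - ?K (u - 1, v) + (c (u, v - 1) - ?K (u, v - 1))
        - (c (u - 1, v - 1) - ?K (u - 1, v - 1))"
      using rec[of u v] sum_corner_coeff_eq_mixed_difference[where N = N and x = x and u = u and v = v]
      by linarith
  qed (use assms(2,3) in \<open>simp_all add: bdry bdry' cell_sum_boundary\<close>)
  then show ?thesis by simp
qed

lemma corner_coeff_Ints: "corner_coeff p q s \<in> \<int>"
  by (cases s) (simp add: corner_coeff_def)

lemma cd_feasible_eq_image:
  "cd_feasible N = (\<lambda>x. (x, corner_differences N x, full_cover N)) ` exact_cover_feasible N"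
proof (intro equalityI subsetI)
  fix t assume "t \<in> cd_feasible N"
  then obtain x d c where t: "t = (x, d, c)" and cd: "(x, d, c) \<in> cd_feasible N"
    by (cases t) auto
  have one: "c (u, v) = 1" if "u \<in> {1..N}" "v \<in> {1..N}" for u v
    using cd that unfolding cd_feasible_def by blast
  have "d = corner_differences N x"
  proof (rule PiE_ext)
    show "d \<in> {1..N + 1} \<times> {1..N + 1} \<rightarrow>\<^sub>E UNIV"
      using cd by (auto simp: cd_feasible_def PiE_def)
    show "corner_differences N x \<in> {1..N + 1} \<times> {1..N + 1} \<rightarrow>\<^sub>E UNIV"
      by (simp add: corner_differences_def)
  qed (use cd in \<open>auto simp: cd_feasible_def corner_differences_def\<close>)
  moreover have "c = full_cover N"
  proof (rule PiE_ext)
    show "c \<in> {0..N} \<times> {0..N} \<rightarrow>\<^sub>E UNIV"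
      using cd by (auto simp: cd_feasible_def PiE_def)
    show "full_cover N \<in> {0..N} \<times> {0..N} \<rightarrow>\<^sub>E UNIV"
      by (simp add: full_cover_def)
    fix p assume "p \<in> {0..N} \<times> {0..N}"
    then obtain u v where p: "p = (u, v)" and uv: "u \<in> {0..N}" "v \<in> {0..N}" by auto
    show "c p = full_cover N p"
    proof (cases "u = 0 \<or> v = 0")
      case True
      then show ?thesis
        using cd_feasible_covers[OF cd uv] p uv by (auto simp: full_cover_simps cell_sum_boundary)
    next
      case False
      then show ?thesis
        using one[of u v] p uv by (simp add: full_cover_simps)
    qed
  qed
  moreover have "x \<in> exact_cover_feasible N"
    unfolding exact_cover_feasible_iff
  proof (intro conjI ballI)
    show "x \<in> placements N \<rightarrow>\<^sub>E {0, 1}"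
      using cd by (simp add: cd_feasible_def)
    fix p assume "p \<in> {1..N} \<times> {1..N}"
    then obtain u v where "p = (u, v)" "u \<in> {1..N}" "v \<in> {1..N}" by auto
    then show "cell_sum N (\<lambda>_. 1) x p = 1"
      using cd_feasible_covers[OF cd, of u v] one[of u v] by simp
  qed
  ultimately show "t \<in> (\<lambda>x. (x, corner_differences N x, full_cover N)) ` exact_cover_feasible N"
    using t by blast
next
  fix t assume "t \<in> (\<lambda>x. (x, corner_differences N x, full_cover N)) ` exact_cover_feasible N"
  then obtain x where t: "t = (x, corner_differences N x, full_cover N)"
    and x: "x \<in> exact_cover_feasible N" by blast
  have x01: "x s \<in> {0, 1}" if "s \<in> placements N" for s
    using x that by (auto simp: exact_cover_feasible_iff)
  have cover: "full_cover N (u, v) = cell_sum N (\<lambda>_. 1) x (u, v)"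
    if "u \<in> {0..N}" "v \<in> {0..N}" for u v
    using that x
    by (cases "u = 0 \<or> v = 0") (auto simp: full_cover_simps cell_sum_boundary exact_cover_feasible_iff)
  have "(\<Sum>s\<in>placements N. corner_coeff p q s * x s) \<in> \<int>" for p q
  proof (intro Ints_sum Ints_mult corner_coeff_Ints)
    fix s assume "s \<in> placements N"
    from x01[OF this] show "x s \<in> \<int>" by auto
  qed
  then have d: "corner_differences N x \<in> {1..N + 1} \<times> {1..N + 1} \<rightarrow>\<^sub>E \<int>"
    by (auto simp: corner_differences_def)
  have c: "full_cover N \<in> {0..N} \<times> {0..N} \<rightarrow>\<^sub>E \<int>"
    by (auto simp: full_cover_def)
  have rec: "full_cover N (u, v) = full_cover N (u - 1, v) + full_cover N (u, v - 1)
      - full_cover N (u - 1, v - 1) + corner_differences N x (u, v)"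
    if "u \<in> {1..N}" "v \<in> {1..N}" for u v
    using that
    by (simp add: cover corner_differences_def sum_corner_coeff_eq_mixed_difference)
  show "t \<in> cd_feasible N"
    unfolding t cd_feasible_def mem_Collect_eq prod.case
    using x d c rec
    by (intro conjI ballI)
      (simp_all add: exact_cover_feasible_iff full_cover_simps corner_differences_def)
qed

section \<open>Optimal values\<close>

lemma finite_exact_cover_feasible: "finite (exact_cover_feasible N)"
proof (rule finite_subset)
  show "exact_cover_feasible N \<subseteq> placements N \<rightarrow>\<^sub>E {0, 1}"
    by (auto simp: exact_cover_feasible_def)
qed (simp add: finite_PiE finite_placements)

lemma exact_cover_feasible_nonempty:
  assumes "N \<ge> 2"
  shows "exact_cover_feasible N \<noteq> {}"
proof -
  \<comment> \<open>The tiling by unit squares.\<close>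
  let ?x = "\<lambda>s\<in>placements N. of_bool (side s = 1) :: real"
  have "cell_sum N (\<lambda>_. 1) ?x (u, v) = 1" if "u \<in> {1..N}" "v \<in> {1..N}" for u v
  proof -
    have "cell_sum N (\<lambda>_. 1) ?x (u, v) = (\<Sum>s\<in>{(u, v, 1 :: int)}. 1)"
      unfolding cell_sum_def
    proof (rule sum.mono_neutral_cong_right)
      show "finite {s \<in> placements N. (u, v) \<in> cells s}"
        using finite_placements by simp
    qed (use that assms in \<open>auto simp: placements_def cells_def side_def\<close>)
    then show ?thesis by simp
  qed
  then have "?x \<in> exact_cover_feasible N"
    by (auto simp: exact_cover_feasible_iff)
  then show ?thesis by blast
qed

lemma optimal_value_restrict:
  assumes S: "finite S" "S \<noteq> {}" and T: "T \<subseteq> S" "\<And>x. x \<in> S \<Longrightarrow> \<exists>y\<in>T. f y = f x"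
  shows "\<exists>z. is_optimal_value f S z \<and> is_optimal_value f T z"
proof -
  obtain x where x: "is_arg_min f (\<lambda>x. x \<in> S) x"
    using ex_is_arg_min_if_finite[OF S] by blast
  then obtain y where "y \<in> T" "f y = f x"
    using T(2) by (auto simp: is_arg_min_def)
  with x T(1) have "is_arg_min f (\<lambda>x. x \<in> T) y"
    by (auto simp: is_arg_min_def)
  with x \<open>f y = f x\<close> show ?thesis
    unfolding is_optimal_value_def by blast
qed

theorem proposition4:
  fixes N :: int
  assumes "N \<ge> 2"
  shows "(\<forall>x\<in>exact_cover_feasible N. \<exists>y\<in>orbit (D4 N) (act_vector N) x.
            y \<in> exact_cover_feasible N \<and> corner_ordered N y) \<and>
         (\<exists>z. is_optimal_value (num_squares N) (exact_cover_feasible N) z \<and>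
              is_optimal_value (num_squares N) {x \<in> exact_cover_feasible N. corner_ordered N x} z) \<and>
         (\<exists>z. is_optimal_value (\<lambda>(x, d, c). num_squares N x) (cd_feasible N) z \<and>
              is_optimal_value (\<lambda>(x, d, c). num_squares N x)
                {(x, d, c) \<in> cd_feasible N. corner_ordered N x} z)"
proof (intro conjI)
  show "\<forall>x\<in>exact_cover_feasible N. \<exists>y\<in>orbit (D4 N) (act_vector N) x.
          y \<in> exact_cover_feasible N \<and> corner_ordered N y"
  proof
    fix x assume "x \<in> exact_cover_feasible N"
    from ex_orbit_corner_ordered[OF this] show "\<exists>y\<in>orbit (D4 N) (act_vector N) x.
        y \<in> exact_cover_feasible N \<and> corner_ordered N y"
      by (auto simp: orbit_def D4_def)
  qed
next
  have ordered: "\<exists>y\<in>exact_cover_feasible N. corner_ordered N y \<and> num_squares N y = num_squares N x"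
    if "x \<in> exact_cover_feasible N" for x
    using ex_orbit_corner_ordered[OF that] num_squares_act_vector by blast
  note fin = finite_exact_cover_feasible and ne = exact_cover_feasible_nonempty[OF assms]
  show "\<exists>z. is_optimal_value (num_squares N) (exact_cover_feasible N) z \<and>
          is_optimal_value (num_squares N) {x \<in> exact_cover_feasible N. corner_ordered N x} z"
    by (rule optimal_value_restrict[OF fin ne]) (use ordered in auto)
  show "\<exists>z. is_optimal_value (\<lambda>(x, d, c). num_squares N x) (cd_feasible N) z \<and>
          is_optimal_value (\<lambda>(x, d, c). num_squares N x)
            {(x, d, c) \<in> cd_feasible N. corner_ordered N x} z"
  proof (rule optimal_value_restrict)
    show "finite (cd_feasible N)" "cd_feasible N \<noteq> {}"
      using fin ne by (simp_all add: cd_feasible_eq_image)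
    fix t assume "t \<in> cd_feasible N"
    then show "\<exists>y\<in>{(x, d, c) \<in> cd_feasible N. corner_ordered N x}.
        (\<lambda>(x, d, c). num_squares N x) y = (\<lambda>(x, d, c). num_squares N x) t"
      using ordered unfolding cd_feasible_eq_image by fastforce
  qed auto
qed

end
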